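(* (i) For every $n\ge 2$, the star $S_n=K_{1,n-1}$ satisfies $D_t(S_n,-1)=1$. (ii) For every $n\ge 1$, the path $P_n$ on $n$ vertices satisfies $D_t(P_n,-1)=1$ if $n\equiv 0,2,3,5\pmod 6$, and $D_t(P_n,-1)=0$ if $n\equiv 1,4\pmod 6$.
   Context: A set $D\subseteq V(G)$ of a finite simple graph $G$ is a total dominating set if every vertex of $G$ is adjacent to some vertex of $D$. With $d_t(G,i)$ the number of total dominating sets of size $i$, the total domination polynomial is $D_t(G,x)=\sum_{i=1}^{|V(G)|}d_t(G,i)x^i$. *)

theory Defs
  imports
    "Graph_Theory.Kuratowski"
    "HOL-Computational_Algebra.Polynomial"
begin

text \<open>
  As in Graph-Theory, a finite simple graph is a term satisfying the locale predicate
  \<^const>\<open>graph\<close>: a finite, symmetric, loop-free digraph without parallel arcs. The definitions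
  below make sense for any \<open>pre_digraph\<close>; they are only used for graphs.
\<close>

definition total_dominating_set :: "('a, 'b) pre_digraph \<Rightarrow> 'a set \<Rightarrow> bool" where
  "total_dominating_set G D \<longleftrightarrow>
     D \<subseteq> verts G \<and> (\<forall>v \<in> verts G. \<exists>u \<in> D. v \<rightarrow>\<^bsub>G\<^esub> u)"

definition total_dominating_count :: "('a, 'b) pre_digraph \<Rightarrow> nat \<Rightarrow> nat" where
  "total_dominating_count G i = card {D. total_dominating_set G D \<and> card D = i}"

definition total_domination_poly :: "('a, 'b) pre_digraph \<Rightarrow> int poly" where
  "total_domination_poly G =
     (\<Sum>i = 1..card (verts G). monom (int (total_dominating_count G i)) i)"

text \<open>
  Stars and paths are specified up to isomorphism, in the same style as
  \<^const>\<open>complete_bipartite_digraph\<close>.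
\<close>

definition star_graph :: "nat \<Rightarrow> ('a, 'b) pre_digraph \<Rightarrow> bool" where
  "star_graph n G \<longleftrightarrow> complete_bipartite_digraph 1 (n - 1) G"

definition path_graph :: "nat \<Rightarrow> ('a, 'b) pre_digraph \<Rightarrow> bool" where
  "path_graph n G \<longleftrightarrow> graph G \<and>
     (\<exists>v. bij_betw v {1..n} (verts G) \<and>
          arcs_ends G = {(v i, v j) | i j. i \<in> {1..n} \<and> j \<in> {1..n} \<and> (j = i + 1 \<or> i = j + 1)})"

text \<open>The specifications are satisfiable for every \<open>n\<close> in question.\<close>

lemma star_graph_exists:
  assumes "n \<ge> 2"
  shows "\<exists>G :: (nat, nat \<times> nat) pre_digraph. star_graph n G"
proof -
  define G where "G = \<lparr>pverts = {..<n}, parcs = {0} \<times> {1..<n} \<union> {1..<n} \<times> {0}\<rparr>"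
  have "pverts G = {0} \<union> {1..<n}"
    using assms by (auto simp: G_def)
  then have "star_graph n (with_proj G)"
    unfolding star_graph_def complete_bipartite_digraph_pair_def
    by (intro conjI exI[of _ "{0}"] exI[of _ "{1..<n}"]) (simp_all add: G_def)
  then show ?thesis by blast
qed

lemma path_graph_exists: "\<exists>G :: (nat, nat \<times> nat) pre_digraph. path_graph n G"
proof -
  define A where "A = {(i, j) | i j. i \<in> {1..n} \<and> j \<in> {1..n} \<and> (j = i + 1 \<or> i = j + 1)}"
  define G where "G = \<lparr>pverts = {1..n}, parcs = A\<rparr>"
  have "A \<subseteq> {1..n} \<times> {1..n}" by (auto simp: A_def)
  then have "finite A" by (rule finite_subset) simp
  have "pair_graph G"
  proof
    show "symmetric (with_proj G)"
      by (auto simp: symmetric_def G_def A_def intro: symI)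
  qed (use \<open>finite A\<close> in \<open>auto simp: G_def A_def\<close>)
  then have "graph (with_proj G)"
    by (rule pair_graph.pair_graphD_graph)
  moreover have "bij_betw id {1..n} (verts (with_proj G))"
    by (simp add: G_def)
  moreover have "arcs_ends (with_proj G) =
      {(id i, id j) | i j. i \<in> {1..n} \<and> j \<in> {1..n} \<and> (j = i + 1 \<or> i = j + 1)}"
    by (simp add: G_def A_def)
  ultimately have "path_graph n (with_proj G)"
    unfolding path_graph_def by blast
  then show ?thesis by blast
qed

end

theory Submission
  imports Defs
begin

text \<open>
  Evaluated at \<open>-1\<close>, the polynomial is the sum of \<open>(-1)^card D\<close> over the total dominating sets
  \<open>D\<close>, so every subfamily closed under toggling one fixed vertex contributes \<open>0\<close>.

  For the star, the sets containing the centre are closed under toggling a leaf, and exactly one of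
  them, the singleton of the centre, is not total dominating; it contributes \<open>-1\<close>.

  For the path on \<open>n + 3\<close> vertices, every total dominating set contains the vertex 2. Those containing
  3 are closed under toggling 1 and cancel. The others contain 1 and 2 but not 3, and what remains is
  exactly a total dominating set of the path \<open>4, \<dots>, n + 3\<close>. So the value at \<open>-1\<close> depends only on
  \<open>n mod 3\<close>, and the cases \<open>n = 0, 1, 2\<close> give \<open>1, 0, 1\<close>.
\<close>

section \<open>Signed counts of total dominating sets\<close>

text \<open>Toggling \<open>x\<close> is an involution on \<open>F\<close> that changes the parity
  of \<open>card D\<close>, so the sum equals its own negative. The parity changes because members
  are finite: \<open>card\<close> of an infinite set is 0.\<close>

lemma sum_card_sign_toggle_eq_0:
  fixes F :: "'a set set"
  assumes fin: "\<And>D. D \<in> F \<Longrightarrow> finite D"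
    and ins: "\<And>D. D \<in> F \<Longrightarrow> insert x D \<in> F"
    and del: "\<And>D. D \<in> F \<Longrightarrow> D - {x} \<in> F"
  shows "(\<Sum>D\<in>F. (-1 :: int) ^ card D) = 0"
proof -
  define t where "t D = (if x \<in> D then D - {x} else insert x D)" for D
  have "(\<Sum>D\<in>F. (-1 :: int) ^ card D) = (\<Sum>D\<in>F. - ((-1) ^ card D))"
  proof (rule sum.reindex_bij_witness[of _ t t])
    fix D assume "D \<in> F"
    show "t (t D) = D" by (auto simp: t_def)
    then show "t (t D) = D" .
    show "t D \<in> F" using \<open>D \<in> F\<close> ins del by (simp add: t_def)
    then show "t D \<in> F" .
    have "finite D" using fin \<open>D \<in> F\<close> by blast
    show "- ((-1) ^ card (t D)) = ((-1 :: int) ^ card D)"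
    proof (cases "x \<in> D")
      case True
      show ?thesis
        by (simp only: t_def True if_True card.remove[OF \<open>finite D\<close> True] power_Suc mult_minus1)
    next
      case False
      then show ?thesis using \<open>finite D\<close> by (simp add: t_def)
    qed
  qed
  then show ?thesis by (simp add: sum_negf)
qed

text \<open>Grouping the sets by cardinality gives the coefficients. The polynomial starts at index
  1 and still misses no set: as soon as there is a vertex, the empty set dominates nothing.\<close>

lemma poly_total_domination_poly:
  assumes "finite (verts G)" and "verts G \<noteq> {}"
  shows "poly (total_domination_poly G) x =
    (\<Sum>D | total_dominating_set G D. x ^ card D)"
proof -
  let ?T = "{D. total_dominating_set G D}"
  have sub: "?T \<subseteq> Pow (verts G)"
    by (auto simp: total_dominating_set_def)
  then have finT: "finite ?T"
    using assms(1) by (simp add: finite_subset)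
  have "card D \<in> {1..card (verts G)}" if "D \<in> ?T" for D
  proof -
    have "D \<subseteq> verts G" "D \<noteq> {}"
      using that assms(2) by (auto simp: total_dominating_set_def)
    then show ?thesis
      using assms(1) by (simp add: card_mono card_gt_0_iff Suc_le_eq finite_subset)
  qed
  then have "(\<Sum>i = 1..card (verts G). \<Sum>D | D \<in> ?T \<and> card D = i. x ^ card D) =
      (\<Sum>D\<in>?T. x ^ card D)"
    by (intro sum.group finT) auto
  then show ?thesis
    by (simp add: total_domination_poly_def total_dominating_count_def poly_sum poly_monom)
qed

section \<open>Stars\<close>

lemma poly_total_domination_poly_star:
  assumes "n \<ge> 2" and "star_graph n G"
  shows "poly (total_domination_poly G) (-1) = 1"
proof -
  obtain U V where G: "graph G" "verts G = U \<union> V" "U \<inter> V = {}" "card U = 1" "card V = n - 1"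
    "arcs_ends G = U \<times> V \<union> V \<times> U"
    using assms(2) by (auto simp: star_graph_def complete_bipartite_digraph_def)
  obtain c where U: "U = {c}" using G(4) by (auto simp: card_1_singleton_iff)
  have c: "c \<notin> V" using G(3) U by blast
  have "card V > 0" using assms(1) G(5) by simp
  then have V: "finite V" "V \<noteq> {}" by (auto simp: card_gt_0_iff)
  then obtain l where l: "l \<in> V" by blast
  define F where "F = {D. c \<in> D \<and> D \<subseteq> insert c V}"
  \<comment> \<open>A leaf has only the neighbour \<open>c\<close>, which forces \<open>c\<close>
    into \<open>D\<close>; the centre itself needs some leaf in \<open>D\<close>, which excludes
    just \<open>{c}\<close>.\<close>
  have TDS: "{D. total_dominating_set G D} = F - {{c}}"
    using l c unfolding F_def total_dominating_set_def G(2,6) U by auto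
  have "finite F" using V(1) by (simp add: F_def)
  moreover have "{c} \<in> F" by (simp add: F_def)
  ultimately have "(\<Sum>D\<in>F. (-1 :: int) ^ card D) = -1 + (\<Sum>D\<in>F - {{c}}. (-1) ^ card D)"
    by (simp add: sum.remove)
  moreover have "(\<Sum>D\<in>F. (-1 :: int) ^ card D) = 0"
    by (rule sum_card_sign_toggle_eq_0[of _ l])
      (use l c V(1) in \<open>auto simp: F_def intro: finite_subset\<close>)
  ultimately show ?thesis
    using V by (simp add: poly_total_domination_poly G(2) U TDS)
qed

section \<open>Paths\<close>

text \<open>The vertex 1 has no left neighbour: there \<open>i - 1 = 0\<close> is never in \<open>D\<close>.\<close>

definition path_total_dominating :: "nat \<Rightarrow> nat set set" where
  "path_total_dominating n =
    {D. D \<subseteq> {1..n} \<and> (\<forall>i\<in>{1..n}. i - 1 \<in> D \<or> i + 1 \<in> D)}"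

text \<open>At \<open>n = 0\<close> the empty set gives 1, whereas the polynomial of the empty graph
  is 0. The value 1 is the one that fits the recurrence in steps of 3.\<close>

definition path_sign_sum :: "nat \<Rightarrow> int" where
  "path_sign_sum n = (\<Sum>D\<in>path_total_dominating n. (-1) ^ card D)"

text \<open>The enumeration \<open>v\<close> carries index sets to vertex sets bijectively,
  preserving cardinality and total domination.\<close>

lemma poly_total_domination_poly_path:
  assumes "n \<ge> 1" and "path_graph n G"
  shows "poly (total_domination_poly G) (-1) = path_sign_sum n"
proof -
  obtain v where bij: "bij_betw v {1..n} (verts G)"
    and arcs: "arcs_ends G =
      {(v i, v j) | i j. i \<in> {1..n} \<and> j \<in> {1..n} \<and> (j = i + 1 \<or> i = j + 1)}"
    using assms(2) by (auto simp: path_graph_def)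
  have inj: "inj_on v {1..n}" and im: "v ` {1..n} = verts G"
    using bij by (auto simp: bij_betw_def)
  have verts: "finite (verts G)" "verts G \<noteq> {}"
    using assms(1) im[symmetric] by auto
  have arc: "v i \<rightarrow>\<^bsub>G\<^esub> v j \<longleftrightarrow> j = i + 1 \<or> i = j + 1" if "i \<in> {1..n}" "j \<in> {1..n}" for i j
    using that inj_on_eq_iff[OF inj] unfolding arcs by auto
  have iff: "total_dominating_set G (v ` D) \<longleftrightarrow> D \<in> path_total_dominating n"
    if "D \<subseteq> {1..n}" for D
  proof -
    have "(\<exists>u\<in>v ` D. v i \<rightarrow>\<^bsub>G\<^esub> u) \<longleftrightarrow> i - 1 \<in> D \<or> i + 1 \<in> D" if i: "i \<in> {1..n}" for i
    proof -
      have "(\<exists>u\<in>v ` D. v i \<rightarrow>\<^bsub>G\<^esub> u) \<longleftrightarrow> (\<exists>j\<in>D. j = i + 1 \<or> i = j + 1)"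
        using arc[OF i] \<open>D \<subseteq> {1..n}\<close> by blast
      \<comment> \<open>Since \<open>i\<close> is at least 1, \<open>i = j + 1\<close> means
        \<open>j = i - 1\<close> even with truncated subtraction.\<close>
      also have "\<dots> \<longleftrightarrow> i - 1 \<in> D \<or> i + 1 \<in> D"
        using i by (cases i) auto
      finally show ?thesis .
    qed
    then show ?thesis
      using that im[symmetric]
      by (simp add: total_dominating_set_def path_total_dominating_def image_mono)
  qed
  have "{D. total_dominating_set G D} = (`) v ` path_total_dominating n"
  proof (intro equalityI subsetI)
    fix E assume E: "E \<in> {D. total_dominating_set G D}"
    then have "E \<subseteq> v ` {1..n}" using im by (simp add: total_dominating_set_def)
    then obtain D where "D \<subseteq> {1..n}" "E = v ` D" by (auto simp: subset_image_iff)
    then show "E \<in> (`) v ` path_total_dominating n" using E iff by blast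
  next
    fix E assume "E \<in> (`) v ` path_total_dominating n"
    then show "E \<in> {D. total_dominating_set G D}"
      using iff by (auto simp: path_total_dominating_def)
  qed
  moreover have "inj_on ((`) v) (path_total_dominating n)"
    by (rule inj_on_subset[OF inj_on_image_Pow[OF inj]]) (auto simp: path_total_dominating_def)
  moreover have "card (v ` D) = card D" if "D \<in> path_total_dominating n" for D
    using that inj by (auto simp: path_total_dominating_def intro: card_image inj_on_subset)
  ultimately show ?thesis
    by (simp add: poly_total_domination_poly[OF verts] path_sign_sum_def sum.reindex)
qed

lemma finite_path_total_dominating: "finite (path_total_dominating n)"
  by (rule finite_subset[of _ "Pow {1..n}"]) (auto simp: path_total_dominating_def)

text \<open>Only vertex 2 can dominate the end vertex 1. For \<open>n = 1\<close> the family is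
  empty.\<close>

lemma path_total_dominating_mem_2:
  assumes "D \<in> path_total_dominating n" and "n \<ge> 1"
  shows "2 \<in> D"
proof -
  have D: "D \<subseteq> {1..n}" "\<forall>i\<in>{1..n}. i - 1 \<in> D \<or> i + 1 \<in> D"
    using assms(1) by (simp_all add: path_total_dominating_def)
  have "0 \<notin> D" using D(1) by auto
  moreover have "1 - 1 \<in> D \<or> 1 + 1 \<in> D"
    using assms(2) by (intro bspec[OF D(2)]) simp
  ultimately show ?thesis by (simp add: numeral_2_eq_2)
qed

text \<open>Vertices 1 and 3 are dominated by 2, and 2 by 1. Vertex 3 is absent, so the vertices
  from 4 on get no help from the left and form an independent copy of the path on \<open>n\<close>
  vertices.\<close>

lemma path_total_dominating_shift:
  assumes D: "D \<subseteq> {1..n}"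
  shows "{1, 2} \<union> (\<lambda>i. i + 3) ` D \<in> path_total_dominating (n + 3) \<longleftrightarrow>
    D \<in> path_total_dominating n"
proof -
  let ?E = "{1, 2} \<union> (\<lambda>i. i + 3) ` D"
  have mem: "i \<in> ?E \<longleftrightarrow> i = 1 \<or> i = 2 \<or> i \<ge> 3 \<and> i - 3 \<in> D" for i
    by (force simp: image_iff)
  have "0 \<notin> D" using D by auto
  \<comment> \<open>At \<open>i = 1\<close> the left neighbours are 3 and 0, each absent from its
    set.\<close>
  then have shift: "i + 3 - 1 \<in> ?E \<or> i + 3 + 1 \<in> ?E \<longleftrightarrow> i - 1 \<in> D \<or> i + 1 \<in> D"
    if "i \<ge> 1" for i
    using that unfolding mem by (cases "i = 1") (auto simp: numeral_eq_Suc)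
  have I: "{1..n + 3} = {1, 2, 3} \<union> (\<lambda>i. i + 3) ` {1..n}"
    unfolding image_add_atLeastAtMost' by auto
  have first: "\<forall>i\<in>{1, 2, 3}. i - 1 \<in> ?E \<or> i + 1 \<in> ?E"
    by auto
  have sub: "?E \<subseteq> {1..n + 3}"
    using D by auto
  have "?E \<in> path_total_dominating (n + 3) \<longleftrightarrow>
      (\<forall>i\<in>{1..n}. i + 3 - 1 \<in> ?E \<or> i + 3 + 1 \<in> ?E)"
    by (simp only: path_total_dominating_def mem_Collect_eq I sub[unfolded I] ball_Un
      ball_simps(9) simp_thms) (use first in blast)
  also have "\<dots> \<longleftrightarrow> D \<in> path_total_dominating n"
    using D shift unfolding path_total_dominating_def by force
  finally show ?thesis .
qed

text \<open>The sets containing 3 cancel; each remaining set is \<open>?h D\<close>, with two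
  elements more than \<open>D\<close>, hence of the same sign.\<close>

lemma path_sign_sum_add_3: "path_sign_sum (n + 3) = path_sign_sum n"
proof -
  let ?W = "path_total_dominating (n + 3)"
  let ?h = "\<lambda>D. {1, 2} \<union> (\<lambda>i. i + 3) ` D :: nat set"
  have mem2: "2 \<in> D" if "D \<in> ?W" for D
    using path_total_dominating_mem_2 that by simp
  have "(\<Sum>D | D \<in> ?W \<and> 3 \<in> D. (-1 :: int) ^ card D) = 0"
  proof (rule sum_card_sign_toggle_eq_0[of _ 1])
    fix D assume "D \<in> {D \<in> ?W. 3 \<in> D}"
    then have D: "D \<in> ?W" "3 \<in> D" "D \<subseteq> {1..n + 3}"
      by (auto simp: path_total_dominating_def)
    show "finite D" using D(3) by (rule finite_subset) simp
    show "insert 1 D \<in> {D \<in> ?W. 3 \<in> D}"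
      using D by (auto simp: path_total_dominating_def)
    \<comment> \<open>Vertex 1 serves as a neighbour only of 2, and 2 keeps its neighbour 3.\<close>
    have "i - 1 \<in> D - {1} \<or> i + 1 \<in> D - {1}" if "i \<in> {1..n + 3}" for i
    proof (cases "i = 2")
      case False
      moreover have "i - 1 \<in> D \<or> i + 1 \<in> D"
        using D(1) that by (simp add: path_total_dominating_def)
      ultimately show ?thesis using that by auto
    qed (use D(2) in simp)
    then show "D - {1} \<in> {D \<in> ?W. 3 \<in> D}"
      using D by (auto simp: path_total_dominating_def)
  qed
  moreover have "{D \<in> ?W. 3 \<notin> D} = ?h ` path_total_dominating n"
  proof (intro equalityI subsetI)
    fix E assume "E \<in> {D \<in> ?W. 3 \<notin> D}"
    then have E: "E \<in> ?W" "3 \<notin> E" "E \<subseteq> {1..n + 3}"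
      by (auto simp: path_total_dominating_def)
    have "2 - 1 \<in> E \<or> 2 + 1 \<in> E"
      using E(1) unfolding path_total_dominating_def by (auto dest: bspec[of _ _ 2])
    then have "1 \<in> E" using E(2) by simp
    define D where "D = {i. i + 3 \<in> E}"
    \<comment> \<open>The index 0 would correspond to vertex 3, which is not in
      \<open>E\<close>.\<close>
    have "i + 3 \<in> E \<Longrightarrow> i \<ge> 1" for i
      using E(2) by (cases i) auto
    then have "D \<subseteq> {1..n}" using E(3) by (auto simp: D_def)
    have "E = ?h D"
    proof (intro set_eqI)
      fix i :: nat
      have "i = 0 \<or> i = 1 \<or> i = 2 \<or> i = 3 \<or> (\<exists>k. i = k + 4)" by presburger
      then consider "i = 0" | "i = 1" | "i = 2" | "i = 3" | k where "i = k + 4" by blast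
      then show "i \<in> E \<longleftrightarrow> i \<in> ?h D"
        using E \<open>1 \<in> E\<close> mem2[OF E(1)] by cases (auto simp: D_def image_iff add.commute)
    qed
    then show "E \<in> ?h ` path_total_dominating n"
      using E(1) path_total_dominating_shift[OF \<open>D \<subseteq> {1..n}\<close>] by blast
  next
    fix E assume "E \<in> ?h ` path_total_dominating n"
    then obtain D where D: "D \<in> path_total_dominating n" "E = ?h D" by blast
    then have "D \<subseteq> {1..n}" by (simp add: path_total_dominating_def)
    then show "E \<in> {D \<in> ?W. 3 \<notin> D}"
      using D path_total_dominating_shift[OF \<open>D \<subseteq> {1..n}\<close>] by auto
  qed
  moreover have "inj_on ?h (path_total_dominating n)"
    \<comment> \<open>Shifting back recovers \<open>D\<close>, because the added elements 1 and 2
      lie below 3.\<close>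
    by (rule inj_on_inverseI[of _ "\<lambda>E. {i. i + 3 \<in> E}"]) auto
  moreover have "card (?h D) = card D + 2" if "D \<in> path_total_dominating n" for D
  proof -
    have "D \<subseteq> {1..n}" using that by (simp add: path_total_dominating_def)
    then have "finite D" "{1, 2} \<inter> (\<lambda>i. i + 3) ` D = {}" by (auto intro: finite_subset)
    then show ?thesis by (subst card_Un_disjoint) (auto simp: card_image)
  qed
  moreover have "path_sign_sum (n + 3) =
      (\<Sum>D | D \<in> ?W \<and> 3 \<in> D. (-1) ^ card D) + (\<Sum>D | D \<in> ?W \<and> 3 \<notin> D. (-1) ^ card D)"
    unfolding path_sign_sum_def
    using sum.Int_Diff[OF finite_path_total_dominating, of _ "n + 3" "{D. 3 \<in> D}"]
    by (simp add: Int_def set_diff_eq)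
  ultimately show ?thesis
    by (simp add: sum.reindex path_sign_sum_def)
qed

lemma path_sign_sum_0: "path_sign_sum 0 = 1"
proof -
  have "path_total_dominating 0 = {{}}"
    by (auto simp: path_total_dominating_def)
  then show ?thesis by (simp add: path_sign_sum_def)
qed

lemma path_sign_sum_1: "path_sign_sum 1 = 0"
proof -
  have "path_total_dominating 1 = {}"
    by (auto simp: path_total_dominating_def)
  then show ?thesis by (simp add: path_sign_sum_def)
qed

lemma path_sign_sum_2: "path_sign_sum 2 = 1"
proof -
  have 2: "{1..2 :: nat} = {1, 2}" by auto
  have "path_total_dominating 2 = {D \<in> Pow {1, 2}. 2 \<in> D \<and> 1 \<in> D}"
    unfolding path_total_dominating_def 2 by (auto simp: numeral_eq_Suc)
  also have "\<dots> = {{1, 2}}" by auto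
  finally show ?thesis by (simp add: path_sign_sum_def)
qed

lemma path_sign_sum_eq: "path_sign_sum n = (if n mod 3 = 1 then 0 else 1)"
proof (induction n rule: less_induct)
  case (less n)
  consider "n = 0" | "n = 1" | "n = 2" | "n \<ge> 3" by linarith
  then show ?case
  proof cases
    case 4
    then obtain m where "n = m + 3" by (metis le_add_diff_inverse2)
    then show ?thesis using less.IH[of m] path_sign_sum_add_3[of m] by simp
  qed (simp_all add: path_sign_sum_0 path_sign_sum_1[simplified] path_sign_sum_2)
qed

theorem theorem6:
  shows "(\<forall>n \<ge> 2. \<forall>G :: ('a, 'b) pre_digraph. star_graph n G \<longrightarrow>
            poly (total_domination_poly G) (-1) = 1) \<and>
         (\<forall>n \<ge> 1. \<forall>G :: ('c, 'd) pre_digraph. path_graph n G \<longrightarrow>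
            (n mod 6 \<in> {0, 2, 3, 5} \<longrightarrow> poly (total_domination_poly G) (-1) = 1) \<and>
            (n mod 6 \<in> {1, 4} \<longrightarrow> poly (total_domination_poly G) (-1) = 0))"
proof -
  \<comment> \<open>As 3 divides 6, the residue mod 6 decides the residue mod 3: 1 and 4 are those
    congruent to 1.\<close>
  have mod_3: "n mod 3 = n mod 6 mod 3" for n :: nat
    by (simp add: mod_mod_cancel)
  have "n mod 3 \<noteq> 1" if "n mod 6 \<in> {0, 2, 3, 5}" for n :: nat
    using that by (subst mod_3) auto
  moreover have "n mod 3 = 1" if "n mod 6 \<in> {1, 4}" for n :: nat
    using that by (subst mod_3) auto
  ultimately have "(n mod 6 \<in> {0, 2, 3, 5} \<longrightarrow> path_sign_sum n = 1) \<and>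
      (n mod 6 \<in> {1, 4} \<longrightarrow> path_sign_sum n = 0)" for n
    using path_sign_sum_eq[of n] by presburger
  then show ?thesis
    by (intro conjI allI impI)
      (simp_all only: poly_total_domination_poly_star poly_total_domination_poly_path)
qed

end
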